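(* For every integer $d \geq 4$, there exists an integral convex polytope $\mathcal{P}$ of dimension $d$ such that each of the coefficients of $n, n^2, \ldots, n^{d-2}$ of the Ehrhart polynomial $i(\mathcal{P},n)$ of $\mathcal{P}$ is negative.
   Context: A convex polytope $\mathcal{P} \subset \mathbb{R}^N$ (the convex hull of a finite nonempty set of points) is called integral if all of its vertices have integer coordinates. For an integral convex polytope $\mathcal{P} \subset \mathbb{R}^N$ of dimension $d$, define $i(\mathcal{P},n) = \sharp(n\mathcal{P} \cap \mathbb{Z}^N)$ for $n = 1, 2, \ldots$, where $n\mathcal{P} = \{ n\alpha : \alpha \in \mathcal{P} \}$ and $\sharp(X)$ denotes the cardinality of a finite set $X$. By a theorem of Ehrhart, $i(\mathcal{P},n)$ is a polynomial in $n$ of degree $d$ (with rational coefficients) with $i(\mathcal{P},0)=1$; it is called the Ehrhart polynomial of $\mathcal{P}$. *)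

theory Defs
  imports
    "HOL-Analysis.Analysis"
    "HOL-Analysis.Finite_Function_Topology"
    "HOL-Computational_Algebra.Polynomial"
begin

text \<open>
  The ambient dimension N is existentially quantified in the statement, so it cannot be a type
  index. We realise \<open>\<real>\<^sup>N\<close> as the subspace of the library's real vector space of finitely supported
  functions on \<open>nat\<close> spanned by the first N coordinates.
\<close>

definition euclidean :: "nat \<Rightarrow> (nat \<Rightarrow>\<^sub>0 real) set" where
  "euclidean N = {x. Poly_Mapping.keys x \<subseteq> {..<N}}"

definition int_lattice :: "nat \<Rightarrow> (nat \<Rightarrow>\<^sub>0 real) set" where
  "int_lattice N = {x \<in> euclidean N. \<forall>i<N. Poly_Mapping.lookup x i \<in> \<int>}"

definition integral_polytope :: "nat \<Rightarrow> (nat \<Rightarrow>\<^sub>0 real) set \<Rightarrow> bool" where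
  "integral_polytope N P \<longleftrightarrow>
     polytope P \<and> P \<noteq> {} \<and> P \<subseteq> euclidean N \<and> (\<forall>v. v extreme_point_of P \<longrightarrow> v \<in> int_lattice N)"

text \<open>
  The library's \<open>aff_dim\<close> requires a type of class \<open>euclidean_space\<close>. The dimension of a nonempty
  set is that of the direction space of its affine hull, which the differences of its points span
  (\<open>dim\<close> of a set is the dimension of its span).
\<close>

definition affine_dim :: "'a::real_vector set \<Rightarrow> nat" where
  "affine_dim P = dim {x - y | x y. x \<in> P \<and> y \<in> P}"

definition ehrhart_count :: "nat \<Rightarrow> (nat \<Rightarrow>\<^sub>0 real) set \<Rightarrow> nat \<Rightarrow> nat" where
  "ehrhart_count N P n = card ((\<lambda>x. real n *\<^sub>R x) ` P \<inter> int_lattice N)"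

text \<open>
  Uniqueness of the polynomial is \<open>ehrhart_poly_eqI\<close> below; existence for integral polytopes is
  Ehrhart's theorem. The value of the polynomial at 0 is not prescribed.
\<close>

definition ehrhart_poly :: "nat \<Rightarrow> (nat \<Rightarrow>\<^sub>0 real) set \<Rightarrow> real poly" where
  "ehrhart_poly N P = (THE p. \<forall>n\<ge>1. poly p (real n) = real (ehrhart_count N P n))"

lemma ehrhart_poly_eqI:
  assumes "\<And>n. n \<ge> 1 \<Longrightarrow> poly p (real n) = real (ehrhart_count N P n)"
  shows "ehrhart_poly N P = p"
  unfolding ehrhart_poly_def
proof (rule the_equality)
  show "\<forall>n\<ge>1. poly p (real n) = real (ehrhart_count N P n)"
    using assms by blast
next
  fix q assume q: "\<forall>n\<ge>1. poly q (real n) = real (ehrhart_count N P n)"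
  have "infinite (real ` {1..})"
    by (simp add: finite_image_iff infinite_Ici)
  moreover have "real ` {1..} \<subseteq> {x. poly (q - p) x = 0}"
    using q assms by auto
  ultimately have "infinite {x. poly (q - p) x = 0}"
    using finite_subset by blast
  then show "q = p"
    using poly_roots_finite[of "q - p"] by auto
qed

end

theory Submission imports Defs
begin

text \<open>
  Let \<open>T\<^sub>m\<close> be the Reeve tetrahedron with vertices \<open>0\<close>, \<open>e\<^sub>0\<close>, \<open>e\<^sub>1\<close> and \<open>e\<^sub>0 + e\<^sub>1 + m e\<^sub>2\<close>. Raising its
  last vertex increases the volume without bound, but the four vertices remain its only lattice
  points and the \<open>n\<^sup>2\<close> term does not change, so the linear coefficient has to compensate:
  for \<open>m = 6 M\<close> the Ehrhart polynomial is \<open>1 + (2 - M) n + n\<^sup>2 + M n\<^sup>3\<close> (\<open>ehrhart_count_reeve\<close>). Forming a prism with a lattice segment of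
  length \<open>l\<close> raises the dimension by one and multiplies the Ehrhart polynomial by \<open>1 + l n\<close>
  (\<open>ehrhart_count_prism\<close>). Hence the product of \<open>T\<^sub>m\<close> with a cube of dimension \<open>k = d - 3\<close> and edge
  length \<open>l\<close> has the Ehrhart polynomial
  \<open>(1 + (2 - M) n + n\<^sup>2 + M n\<^sup>3) (1 + l n)\<^sup>k\<close>.

  Write \<open>b\<^sub>i\<close> for the coefficient \<open>(k choose i) l\<^sup>i\<close> of \<open>n\<^sup>i\<close> in \<open>(1 + l n)\<^sup>k\<close>, with
  \<open>b\<^sub>i = 0\<close> for negative \<open>i\<close>. In the coefficient of \<open>n\<^sup>j\<close> of the product the part that is linear in \<open>M\<close> is \<open>M (b\<^bsub>j-3\<^esub> - b\<^bsub>j-1\<^esub>)\<close>, and the rest,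
  \<open>b\<^sub>j + 2 b\<^bsub>j-1\<^esub> + b\<^bsub>j-2\<^esub>\<close>, does not depend on \<open>M\<close>. The edge length \<open>l = k + 1\<close> is long enough to make
  \<open>b\<^sub>0 < b\<^sub>1 < \<dots> < b\<^sub>k\<close> (\<open>binomial_terms_increase\<close>), so the integer \<open>b\<^bsub>j-3\<^esub> - b\<^bsub>j-1\<^esub>\<close> is at most
  \<open>-1\<close> whenever \<open>1 \<le> j \<le> k + 1 = d - 2\<close>, and any \<open>M > 4 b\<^sub>k\<close> makes all these coefficients negative
  (\<open>reeve_prism_coeff_negative\<close>).
\<close>

section \<open>Coordinates of finitely supported functions\<close>

definition axis_vec :: "nat \<Rightarrow> nat \<Rightarrow>\<^sub>0 real" where
  "axis_vec i = Poly_Mapping.single i 1"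

lemma lookup_axis_vec [simp]: "Poly_Mapping.lookup (axis_vec i) j = (if i = j then 1 else 0)"
  by (simp add: axis_vec_def lookup_single when_def)

lemma lookup_scaleR [simp]:
  fixes x :: "'a \<Rightarrow>\<^sub>0 'b::real_vector"
  shows "Poly_Mapping.lookup (r *\<^sub>R x) i = r *\<^sub>R Poly_Mapping.lookup x i"
proof -
  have "finite {i. r *\<^sub>R Poly_Mapping.lookup x i \<noteq> 0}"
    by (rule finite_subset[OF _ finite_lookup[of x]]) auto
  then show ?thesis
    by (simp add: scaleR_poly_mapping_def)
qed

lemma mem_euclidean_iff: "x \<in> euclidean N \<longleftrightarrow> (\<forall>i\<ge>N. Poly_Mapping.lookup x i = 0)"
  by (auto simp: euclidean_def in_keys_iff subset_iff not_less) (metis not_less)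

lemma subspace_euclidean: "subspace (euclidean N)"
  by (auto simp: subspace_def mem_euclidean_iff lookup_add)

lemma axis_vec_in_euclidean: "i < N \<Longrightarrow> axis_vec i \<in> euclidean N"
  by (auto simp: mem_euclidean_iff)

lemma euclidean_expansion:
  assumes "x \<in> euclidean N"
  shows "x = (\<Sum>i<N. Poly_Mapping.lookup x i *\<^sub>R axis_vec i)"
proof (rule poly_mapping_eqI)
  fix j
  show "Poly_Mapping.lookup x j = Poly_Mapping.lookup (\<Sum>i<N. Poly_Mapping.lookup x i *\<^sub>R axis_vec i) j"
    using assms by (cases "j < N")
      (auto simp: lookup_sum mem_euclidean_iff if_distrib cong: if_cong)
qed

lemma euclidean_3_eqI:
  assumes "x \<in> euclidean 3" "y \<in> euclidean 3"
    and "Poly_Mapping.lookup x 0 = Poly_Mapping.lookup y 0"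
    and "Poly_Mapping.lookup x 1 = Poly_Mapping.lookup y 1"
    and "Poly_Mapping.lookup x 2 = Poly_Mapping.lookup y 2"
  shows "x = y"
proof (rule poly_mapping_eqI)
  fix j :: nat
  consider "j = 0" | "j = 1" | "j = 2" | "j \<ge> 3" by linarith
  then show "Poly_Mapping.lookup x j = Poly_Mapping.lookup y j"
    using assms by cases (auto simp: mem_euclidean_iff)
qed

lemma dim_euclidean: "dim (euclidean N) = N"
proof (rule dim_unique)
  show "axis_vec ` {..<N} \<subseteq> euclidean N"
    by (auto intro: axis_vec_in_euclidean)
  show "euclidean N \<subseteq> span (axis_vec ` {..<N})"
  proof
    fix x assume "x \<in> euclidean N"
    then show "x \<in> span (axis_vec ` {..<N})"
      by (subst euclidean_expansion, assumption) (auto intro!: span_sum span_scale intro: span_base)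
  qed
  have inj: "inj_on axis_vec {..<N}"
    by (auto simp: inj_on_def) (metis lookup_axis_vec zero_neq_one)
  then show "card (axis_vec ` {..<N}) = N"
    by (simp add: card_image)
  show "independent (axis_vec ` {..<N})"
  proof (rule independent_if_scalars_zero)
    fix f :: "(nat \<Rightarrow>\<^sub>0 real) \<Rightarrow> real" and v
    assume sum0: "(\<Sum>x\<in>axis_vec ` {..<N}. f x *\<^sub>R x) = 0" and "v \<in> axis_vec ` {..<N}"
    then obtain j where j: "j < N" "v = axis_vec j" by auto
    have "0 = Poly_Mapping.lookup (\<Sum>i<N. f (axis_vec i) *\<^sub>R axis_vec i) j"
      using sum0 by (simp add: sum.reindex[OF inj])
    also have "\<dots> = f v"
      using j by (simp add: lookup_sum if_distrib cong: if_cong)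
    finally show "f v = 0" by simp
  qed simp
qed

section \<open>Full-dimensional lattice polytopes\<close>

text \<open>
  This is the invariant that is carried through the iterated prism construction. Giving the polytope
  as the hull of some finite set of lattice points avoids determining its vertices, and
  full-dimensionality, in the form that every axis direction is spanned by differences of points,
  passes from a polytope to the prism by adjoining one direction.
\<close>
definition full_lattice_polytope :: "nat \<Rightarrow> (nat \<Rightarrow>\<^sub>0 real) set \<Rightarrow> bool" where
  "full_lattice_polytope N P \<longleftrightarrow>
     (\<exists>S. finite S \<and> S \<noteq> {} \<and> S \<subseteq> int_lattice N \<and> P = convex hull S) \<and>
     axis_vec ` {..<N} \<subseteq> span {x - y | x y. x \<in> P \<and> y \<in> P}"

lemma full_lattice_polytope_subset:
  assumes "full_lattice_polytope N P"
  shows "P \<subseteq> euclidean N"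
proof -
  obtain S where "S \<subseteq> int_lattice N" "P = convex hull S"
    using assms by (auto simp: full_lattice_polytope_def)
  then show ?thesis
    using hull_minimal[of S "euclidean N" convex] subspace_imp_convex[OF subspace_euclidean]
    by (auto simp: int_lattice_def)
qed

lemma full_lattice_polytope_integral:
  assumes "full_lattice_polytope N P"
  shows "integral_polytope N P"
proof -
  obtain S where "finite S" "S \<noteq> {}" "S \<subseteq> int_lattice N" "P = convex hull S"
    using assms by (auto simp: full_lattice_polytope_def)
  then show ?thesis
    using full_lattice_polytope_subset[OF assms]
    by (auto simp: integral_polytope_def polytope_def dest: extreme_point_of_convex_hull)
qed

lemma full_lattice_polytope_affine_dim:
  assumes "full_lattice_polytope N P"
  shows "affine_dim P = N"
proof -
  let ?D = "{x - y | x y. x \<in> P \<and> y \<in> P}"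
  have "?D \<subseteq> euclidean N"
    using full_lattice_polytope_subset[OF assms] by (auto intro!: subspace_diff subspace_euclidean)
  then have "span ?D \<subseteq> euclidean N"
    by (rule span_minimal) (rule subspace_euclidean)
  moreover have "euclidean N \<subseteq> span ?D"
  proof
    fix x assume "x \<in> euclidean N"
    then show "x \<in> span ?D"
      using assms
      by (subst euclidean_expansion) (auto simp: full_lattice_polytope_def intro!: span_sum span_scale)
  qed
  ultimately have "span ?D = euclidean N"
    by (rule subset_antisym)
  then have "dim (span ?D) = N"
    by (simp only: dim_euclidean)
  then show ?thesis by (simp only: affine_dim_def dim_span)
qed

section \<open>Prisms over lattice polytopes\<close>

definition prism :: "nat \<Rightarrow> nat \<Rightarrow> (nat \<Rightarrow>\<^sub>0 real) set \<Rightarrow> (nat \<Rightarrow>\<^sub>0 real) set" where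
  "prism N l P = (\<lambda>(x, t). x + t *\<^sub>R axis_vec N) ` (P \<times> {0..real l})"

text \<open>
  The prism is a linear image of \<open>P \<times> [0, l]\<close>, and convex hulls commute with products and linear
  images; so it is the hull of two copies of the lattice points whose hull is \<open>P\<close>.
\<close>
lemma full_lattice_polytope_prism:
  assumes P: "full_lattice_polytope N P" and "l > 0"
  shows "full_lattice_polytope (Suc N) (prism N l P)"
proof -
  let ?f = "\<lambda>(x, t). x + t *\<^sub>R axis_vec N"
  let ?D = "\<lambda>P. {x - y | x y. x \<in> P \<and> y \<in> P}"
  obtain S where S: "finite S" "S \<noteq> {}" "S \<subseteq> int_lattice N" "P = convex hull S"
    and ax: "axis_vec ` {..<N} \<subseteq> span (?D P)"
    using P by (auto simp: full_lattice_polytope_def)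
  have seg: "{0..real l} = convex hull {0, real l}"
    by (simp flip: segment_convex_hull add: closed_segment_eq_real_ivl)
  have lin: "linear ?f"
    by (rule linearI) (auto simp: algebra_simps)
  have hull: "prism N l P = convex hull (?f ` (S \<times> {0, real l}))"
    by (simp only: prism_def seg S(4) convex_hull_Times[symmetric] convex_hull_linear_image[OF lin])
  have lat: "?f ` (S \<times> {0, real l}) \<subseteq> int_lattice (Suc N)"
    using S(3) by (force simp: int_lattice_def mem_euclidean_iff lookup_add subset_iff)
  have "P \<subseteq> prism N l P"
    by (force simp: prism_def)
  then have "span (?D P) \<subseteq> span (?D (prism N l P))"
    by (intro span_mono) blast
  moreover have "axis_vec N \<in> span (?D (prism N l P))"
  proof -
    obtain p where "p \<in> P" using S(2,4) by fastforce
    then have "p + real l *\<^sub>R axis_vec N \<in> prism N l P" "p \<in> prism N l P"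
      by (force simp: prism_def)+
    then have "(p + real l *\<^sub>R axis_vec N) - p \<in> span (?D (prism N l P))"
      by (intro span_base) blast
    then have "(1 / real l) *\<^sub>R ((p + real l *\<^sub>R axis_vec N) - p) \<in> span (?D (prism N l P))"
      by (rule span_scale)
    moreover have "(1 / real l) *\<^sub>R ((p + real l *\<^sub>R axis_vec N) - p) = axis_vec N"
      using \<open>l > 0\<close> by simp
    ultimately show ?thesis by (simp only:)
  qed
  ultimately have "axis_vec ` {..<Suc N} \<subseteq> span (?D (prism N l P))"
    using ax by (auto simp: lessThan_Suc)
  then show ?thesis
    unfolding full_lattice_polytope_def using S hull lat
    by (intro conjI exI[of _ "?f ` (S \<times> {0, real l})"]) auto
qed

text \<open>
  A lattice point of the dilated prism splits uniquely into a lattice point of the dilate of \<open>P\<close> and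
  an integer height between \<open>0\<close> and \<open>n l\<close>.
\<close>
lemma ehrhart_count_prism:
  assumes P: "P \<subseteq> euclidean N" and n: "n \<ge> 1"
  shows "ehrhart_count (Suc N) (prism N l P) n = ehrhart_count N P n * (n * l + 1)"
proof -
  let ?A = "(\<lambda>x. real n *\<^sub>R x) ` P \<inter> int_lattice N"
  let ?B = "(\<lambda>x. real n *\<^sub>R x) ` prism N l P \<inter> int_lattice (Suc N)"
  let ?g = "\<lambda>(x, j). x + real j *\<^sub>R axis_vec N"
  have "inj_on ?g (?A \<times> {0..n * l})"
  proof (rule inj_onI, clarify)
    fix x y :: "nat \<Rightarrow>\<^sub>0 real" and i j :: nat
    assume "x \<in> int_lattice N" "y \<in> int_lattice N"
      and eq: "x + real i *\<^sub>R axis_vec N = y + real j *\<^sub>R axis_vec N"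
    then have "Poly_Mapping.lookup x N = 0" "Poly_Mapping.lookup y N = 0"
      by (auto simp: int_lattice_def mem_euclidean_iff)
    then have "i = j"
      using arg_cong[OF eq, of "\<lambda>z. Poly_Mapping.lookup z N"] by (simp add: lookup_add)
    with eq show "x = y \<and> i = j" by simp
  qed
  moreover have "?g ` (?A \<times> {0..n * l}) = ?B"
  proof (intro equalityI subsetI)
    fix z assume "z \<in> ?g ` (?A \<times> {0..n * l})"
    then obtain p j where p: "p \<in> P" "real n *\<^sub>R p \<in> int_lattice N" "j \<le> n * l"
      and z: "z = real n *\<^sub>R p + real j *\<^sub>R axis_vec N"
      by auto
    have "real j \<le> real n * real l"
      using p(3) by (metis of_nat_le_iff of_nat_mult)
    then have "real j / real n \<le> real l"
      using n by (simp add: field_simps)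
    then have "p + (real j / real n) *\<^sub>R axis_vec N \<in> prism N l P"
      using p(1) by (force simp: prism_def)
    moreover have "z = real n *\<^sub>R (p + (real j / real n) *\<^sub>R axis_vec N)"
      using n z by (simp add: scaleR_add_right)
    moreover have "z \<in> int_lattice (Suc N)"
      using p(2) by (auto simp: z int_lattice_def mem_euclidean_iff lookup_add less_Suc_eq)
    ultimately show "z \<in> ?B" by blast
  next
    fix z assume "z \<in> ?B"
    then obtain p t where p: "p \<in> P" "0 \<le> t" "t \<le> real l"
      and z: "z = real n *\<^sub>R (p + t *\<^sub>R axis_vec N)" and lat: "z \<in> int_lattice (Suc N)"
      by (auto simp: prism_def)
    have p0: "\<forall>i\<ge>N. Poly_Mapping.lookup p i = 0"
      using p(1) P by (auto simp: mem_euclidean_iff)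
    then have "Poly_Mapping.lookup z N = real n * t"
      by (simp add: z lookup_add)
    then have "real n * t \<in> \<int>"
      using lat by (auto simp: int_lattice_def)
    moreover have "0 \<le> real n * t" using p by simp
    ultimately obtain j where j: "real n * t = real j"
      by (metis Ints_cases nonneg_int_cases of_int_0_le_iff of_int_of_nat_eq)
    have "real j \<le> real (n * l)"
      using p(3) n by (simp flip: j)
    then have "j \<le> n * l" by (simp only: of_nat_le_iff)
    have z': "z = real n *\<^sub>R p + real j *\<^sub>R axis_vec N"
      by (simp add: z scaleR_add_right j)
    have "real n *\<^sub>R p \<in> int_lattice N"
    proof -
      have "Poly_Mapping.lookup (real n *\<^sub>R p) i \<in> \<int>" if "i < N" for i
      proof -
        have "Poly_Mapping.lookup z i \<in> \<int>" using lat that by (auto simp: int_lattice_def)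
        then show ?thesis using that by (simp add: z' lookup_add)
      qed
      then show ?thesis using p0 by (auto simp: int_lattice_def mem_euclidean_iff)
    qed
    with p(1) \<open>j \<le> n * l\<close> have "(real n *\<^sub>R p, j) \<in> ?A \<times> {0..n * l}" by auto
    then show "z \<in> ?g ` (?A \<times> {0..n * l})"
      by (rule rev_image_eqI) (simp add: z')
  qed
  ultimately have "card ?B = card (?A \<times> {0..n * l})"
    using card_image by metis
  then show ?thesis
    by (simp add: ehrhart_count_def card_cartesian_product)
qed

section \<open>Reeve tetrahedra\<close>

definition reeve_vertices :: "nat \<Rightarrow> (nat \<Rightarrow>\<^sub>0 real) set" where
  "reeve_vertices m = {0, axis_vec 0, axis_vec 1, axis_vec 0 + axis_vec 1 + real m *\<^sub>R axis_vec 2}"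

text \<open>
  The four inequalities are the facets. A point \<open>(x, y, z)\<close> has the barycentric coordinates
  \<open>1 - x - y + c\<close>, \<open>x - c\<close>, \<open>y - c\<close> and \<open>c = z / m\<close>, and the inequalities say that these are
  nonnegative.
\<close>
lemma reeve_inequalities:
  assumes "m > 0"
  shows "convex hull reeve_vertices m =
    {v \<in> euclidean 3. let x = Poly_Mapping.lookup v 0; y = Poly_Mapping.lookup v 1;
        z = Poly_Mapping.lookup v 2
      in 0 \<le> z \<and> z \<le> m * x \<and> z \<le> m * y \<and> m * (x + y - 1) \<le> z}" (is "_ = ?T")
proof
  have "convex ?T"
  proof (rule convexI)
    fix v w :: "nat \<Rightarrow>\<^sub>0 real" and a b :: real
    assume v: "v \<in> ?T" and w: "w \<in> ?T" and ab: "0 \<le> a" "0 \<le> b" "a + b = 1"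
    have "a *\<^sub>R v + b *\<^sub>R w \<in> euclidean 3"
      using v w by (intro subspace_add subspace_scale subspace_euclidean) auto
    moreover
    let ?l = Poly_Mapping.lookup
    have cmb: "a * p + b * q \<le> a * p' + b * q'" if "p \<le> p'" "q \<le> q'" for p q p' q'
      using that ab by (intro add_mono mult_left_mono) auto
    have "a * 0 + b * 0 \<le> a * ?l v 2 + b * ?l w 2"
      "a * ?l v 2 + b * ?l w 2 \<le> a * (m * ?l v 0) + b * (m * ?l w 0)"
      "a * ?l v 2 + b * ?l w 2 \<le> a * (m * ?l v 1) + b * (m * ?l w 1)"
      "a * (m * (?l v 0 + ?l v 1 - 1)) + b * (m * (?l w 0 + ?l w 1 - 1)) \<le> a * ?l v 2 + b * ?l w 2"
      using v w by (intro cmb; simp add: Let_def)+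
    moreover have "a * (m * (?l v 0 + ?l v 1 - 1)) + b * (m * (?l w 0 + ?l w 1 - 1))
        = m * (a * ?l v 0 + b * ?l w 0 + (a * ?l v 1 + b * ?l w 1) - (a + b))"
      by (simp add: algebra_simps)
    ultimately show "a *\<^sub>R v + b *\<^sub>R w \<in> ?T"
      by (simp add: Let_def lookup_add ab(3) algebra_simps)
  qed
  moreover have "reeve_vertices m \<subseteq> ?T"
    by (auto simp: reeve_vertices_def Let_def mem_euclidean_iff lookup_add)
  ultimately show "convex hull reeve_vertices m \<subseteq> ?T"
    by (intro hull_minimal) auto
next
  show "?T \<subseteq> convex hull reeve_vertices m"
  proof
    fix v assume v: "v \<in> ?T"
    define x y z where "x = Poly_Mapping.lookup v 0" "y = Poly_Mapping.lookup v 1"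
      "z = Poly_Mapping.lookup v 2"
    define c where "c = z / m"
    have ineq: "0 \<le> c" "c \<le> x" "c \<le> y" "x + y - c \<le> 1"
      using v assms by (auto simp: c_def x_y_z_def Let_def field_simps)
    define a where "a = (!) [1 - (x + y - c), x - c, y - c, c]"
    define p where "p = (!) [0, axis_vec 0, axis_vec 1, axis_vec 0 + axis_vec 1 + real m *\<^sub>R axis_vec 2]"
    have "(\<Sum>i<4. a i *\<^sub>R p i) \<in> convex hull reeve_vertices m"
    proof (rule convex_sum)
      show "(\<Sum>i<4. a i) = 1"
        by (simp add: a_def eval_nat_numeral)
      show "0 \<le> a i" if "i \<in> {..<4}" for i
        using that ineq by (auto simp: a_def eval_nat_numeral less_Suc_eq)
      show "p i \<in> convex hull reeve_vertices m" if "i \<in> {..<4}" for i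
        using that
        by (intro hull_inc) (auto simp: p_def reeve_vertices_def eval_nat_numeral less_Suc_eq)
    qed auto
    also have "(\<Sum>i<4. a i *\<^sub>R p i) = (x - c) *\<^sub>R axis_vec 0 + (y - c) *\<^sub>R axis_vec 1
        + c *\<^sub>R (axis_vec 0 + axis_vec 1 + real m *\<^sub>R axis_vec 2)"
      by (simp add: a_def p_def numeral_eq_Suc)
    also have "\<dots> = v"
      using v assms
      by (intro euclidean_3_eqI)
        (auto simp: x_y_z_def c_def mem_euclidean_iff lookup_add)
    finally show "v \<in> convex hull reeve_vertices m" .
  qed
qed

lemma full_lattice_polytope_reeve:
  assumes "m > 0"
  shows "full_lattice_polytope 3 (convex hull reeve_vertices m)"
proof -
  let ?P = "convex hull reeve_vertices m"
  let ?D = "{x - y | x y. x \<in> ?P \<and> y \<in> ?P}"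
  let ?w = "axis_vec 0 + axis_vec 1 + real m *\<^sub>R axis_vec 2"
  have vert: "v \<in> span ?D" if "v \<in> reeve_vertices m" for v
  proof -
    have "0 \<in> ?P" "v \<in> ?P"
      using that by (auto simp: reeve_vertices_def intro: hull_inc)
    then have "v - 0 \<in> ?D" by blast
    then have "v - 0 \<in> span ?D" by (rule span_base)
    then show ?thesis by simp
  qed
  have e: "axis_vec 0 \<in> span ?D" "axis_vec 1 \<in> span ?D" "?w \<in> span ?D"
    by (rule vert; simp add: reeve_vertices_def)+
  then have "(1 / real m) *\<^sub>R (?w - axis_vec 0 - axis_vec 1) \<in> span ?D"
    by (intro span_scale span_diff)
  moreover have "(1 / real m) *\<^sub>R (?w - axis_vec 0 - axis_vec 1) = axis_vec 2"
    using assms by simp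
  ultimately have "axis_vec 2 \<in> span ?D" by (simp only:)
  with e have "axis_vec ` {..<3} \<subseteq> span ?D"
    by (auto simp: eval_nat_numeral less_Suc_eq)
  moreover have "reeve_vertices m \<subseteq> int_lattice 3"
    by (auto simp: reeve_vertices_def int_lattice_def mem_euclidean_iff lookup_add)
  ultimately show ?thesis
    unfolding full_lattice_polytope_def
    by (intro conjI exI[of _ "reeve_vertices m"]) (auto simp: reeve_vertices_def)
qed

lemma sum_real_atMost: "(\<Sum>x\<le>n. real x) = real n * (real n + 1) / 2"
  by (induction n) (auto simp: field_simps)

lemma sum_min_square:
  "(\<Sum>x\<le>n. \<Sum>y\<le>n. real (min x y)) = real n * (real n + 1) * (2 * real n + 1) / 6"
proof (induction n)
  case (Suc n)
  have row: "(\<Sum>x\<le>n. real (min x (Suc n))) = real n * (real n + 1) / 2"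
  proof -
    have "(\<Sum>x\<le>n. real (min x (Suc n))) = (\<Sum>x\<le>n. real x)"
      by (intro sum.cong) auto
    also have "\<dots> = real n * (real n + 1) / 2"
      by (rule sum_real_atMost)
    finally show ?thesis .
  qed
  moreover have "(\<Sum>y\<le>n. real (min (Suc n) y)) = real n * (real n + 1) / 2"
    using row by (simp add: min.commute)
  ultimately show ?case
    using Suc by (simp add: sum.distrib field_simps)
qed simp

text \<open>
  The \<open>n\<close>-th dilate lies over the square \<open>[0, n]\<^sup>2\<close>, and over its lattice point \<open>(x, y)\<close> the heights run
  through the integers from \<open>max 0 (m (x + y - n))\<close> to \<open>m min x y\<close>. Since
  \<open>max 0 (x + y - n) = x - min x (n - y)\<close>, the reflection \<open>y \<mapsto> n - y\<close> of the square reduces the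
  count to the sum of \<open>2 min x y - x\<close>.
\<close>
lemma ehrhart_count_reeve:
  assumes m: "m > 0" and n: "n \<ge> 1"
  shows "real (ehrhart_count 3 (convex hull reeve_vertices m) n)
    = (real n + 1)^2 + real m * (real n ^ 3 - real n) / 6"
proof -
  let ?L = "(\<lambda>v. real n *\<^sub>R v) ` (convex hull reeve_vertices m) \<inter> int_lattice 3"
  \<comment> \<open>the lattice heights over a point of the square\<close>
  define F where "F = (\<lambda>(x::nat, y::nat). {max 0 (int m * (int x + int y - int n))..int m * int (min x y)})"
  define g :: "(nat \<times> nat) \<times> int \<Rightarrow> nat \<Rightarrow>\<^sub>0 real" where
    "g = (\<lambda>((x, y), z). real x *\<^sub>R axis_vec 0 + real y *\<^sub>R axis_vec 1 + real_of_int z *\<^sub>R axis_vec 2)"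
  let ?I = "Sigma ({..n} \<times> {..n}) F"
  have g_lookup: "Poly_Mapping.lookup (g ((x, y), z)) 0 = x" "Poly_Mapping.lookup (g ((x, y), z)) 1 = y"
    "Poly_Mapping.lookup (g ((x, y), z)) 2 = z" "g ((x, y), z) \<in> euclidean 3" for x y z
    by (auto simp: g_def lookup_add mem_euclidean_iff)
  have "inj_on g ?I"
  proof (rule inj_onI)
    fix p q :: "(nat \<times> nat) \<times> int"
    assume eq: "g p = g q"
    obtain x y z x' y' z' where "p = ((x, y), z)" "q = ((x', y'), z')"
      by (metis surj_pair)
    then show "p = q"
      using eq g_lookup(1-3)[of x y z] g_lookup(1-3)[of x' y' z'] by simp
  qed
  \<comment> \<open>the facet inequalities of the dilate: only the last one has a constant term to scale\<close>
  have mem_dilate: "v \<in> (\<lambda>v. real n *\<^sub>R v) ` (convex hull reeve_vertices m) \<longleftrightarrow> v \<in> euclidean 3 \<and>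
      0 \<le> Poly_Mapping.lookup v 2 \<and> Poly_Mapping.lookup v 2 \<le> m * Poly_Mapping.lookup v 0 \<and>
      Poly_Mapping.lookup v 2 \<le> m * Poly_Mapping.lookup v 1 \<and>
      m * (Poly_Mapping.lookup v 0 + Poly_Mapping.lookup v 1 - n) \<le> Poly_Mapping.lookup v 2" (is "?l \<longleftrightarrow> ?r") for v
  proof -
    have "?l \<longleftrightarrow> (1 / real n) *\<^sub>R v \<in> convex hull reeve_vertices m"
      using n by (auto simp: image_iff intro!: bexI[of _ "(1 / real n) *\<^sub>R v"])
    also have "\<dots> \<longleftrightarrow> ?r"
    proof -
      have "m * (a / n + b / n - 1) \<le> c / n \<longleftrightarrow> m * (a + b - n) \<le> c" for a b c :: real
      proof -
        have "m * (a / n + b / n - 1) = m * (a + b - n) / n"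
          using n by (simp add: field_simps)
        then show ?thesis using n by (simp add: divide_le_cancel)
      qed
      moreover have "c / n \<le> m * (a / n) \<longleftrightarrow> c \<le> m * a" for a c :: real
        using n by (simp add: divide_le_cancel)
      ultimately show ?thesis
        using n by (simp add: reeve_inequalities[OF m] Let_def mem_euclidean_iff zero_le_divide_iff)
    qed
    finally show ?thesis .
  qed
  have "g ` ?I = ?L"
  proof (intro equalityI subsetI)
    fix v assume "v \<in> g ` ?I"
    then obtain x y z where xyz: "x \<le> n" "y \<le> n" "z \<in> F (x, y)" and v: "v = g ((x, y), z)"
      by auto
    have "int m * int (min x y) \<le> int m * int x" "int m * int (min x y) \<le> int m * int y"
      by (intro mult_left_mono; simp)+
    then have "0 \<le> z" "int m * (int x + int y - int n) \<le> z" "z \<le> int m * int x" "z \<le> int m * int y"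
      using xyz(3) by (auto simp: F_def simp del: mult_le_cancel_left)
    then have "0 \<le> real_of_int z" "real_of_int (int m * (int x + int y - int n)) \<le> real_of_int z"
       "real_of_int z \<le> real_of_int (int m * int x)" "real_of_int z \<le> real_of_int (int m * int y)"
      unfolding of_int_le_iff of_int_0_le_iff by auto
    then have "v \<in> (\<lambda>v. real n *\<^sub>R v) ` (convex hull reeve_vertices m)"
      unfolding mem_dilate v g_lookup(1-3) using g_lookup(4) by simp
    moreover have "v \<in> int_lattice 3"
      using g_lookup by (auto simp: v int_lattice_def eval_nat_numeral less_Suc_eq)
    ultimately show "v \<in> ?L" by simp
  next
    fix v assume v: "v \<in> ?L"
    then have "\<forall>i<3. Poly_Mapping.lookup v i \<in> \<int>" by (auto simp: int_lattice_def)
    then have "Poly_Mapping.lookup v 0 \<in> \<int>" "Poly_Mapping.lookup v 1 \<in> \<int>" "Poly_Mapping.lookup v 2 \<in> \<int>"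
      by simp_all
    then obtain x y z :: int where xyz: "Poly_Mapping.lookup v 0 = x" "Poly_Mapping.lookup v 1 = y"
       "Poly_Mapping.lookup v 2 = z"
      by (elim Ints_cases) blast
    have v': "v \<in> euclidean 3" "0 \<le> real_of_int z" "real_of_int z \<le> m * real_of_int x"
       "real_of_int z \<le> m * real_of_int y" "m * (real_of_int x + y - n) \<le> real_of_int z"
      using IntD1[OF v] unfolding mem_dilate xyz by simp_all
    have "real_of_int 0 \<le> real_of_int z" "real_of_int z \<le> real_of_int (int m * x)"
      "real_of_int z \<le> real_of_int (int m * y)" "real_of_int (int m * (x + y - int n)) \<le> real_of_int z"
      using v'(2-5) by simp_all
    then have z: "0 \<le> z" "z \<le> int m * x" "z \<le> int m * y" "int m * (x + y - int n) \<le> z"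
      unfolding of_int_le_iff .
    have "0 \<le> int m * x" "0 \<le> int m * y"
      using z(1-3) by linarith+
    then have x0: "0 \<le> x" "0 \<le> y"
      using m by (simp_all add: zero_le_mult_iff)
    have "int m * (x + y - int n) \<le> int m * x" "int m * (x + y - int n) \<le> int m * y"
      using z by linarith+
    then have xn: "x \<le> int n" "y \<le> int n"
      using m by (simp_all add: mult_le_cancel_left)
    have "z \<in> F (nat x, nat y)"
      using z x0 by (auto simp: F_def min_def)
    moreover have "v = g ((nat x, nat y), z)"
      using g_lookup x0 xyz by (intro euclidean_3_eqI v'(1)) simp_all
    ultimately show "v \<in> g ` ?I"
      using xn x0 by (intro image_eqI[of _ _ "((nat x, nat y), z)"]) auto
  qed
  then have "card ?L = card ?I"
    using card_image[OF \<open>inj_on g ?I\<close>] by simp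
  also have "\<dots> = (\<Sum>p\<in>{..n} \<times> {..n}. card (F p))"
    by (rule card_SigmaI) (auto simp: F_def)
  finally have "real (card ?L) = (\<Sum>x\<le>n. \<Sum>y\<le>n. real (card (F (x, y))))"
    by (simp add: sum.cartesian_product)
  also have "\<dots> = (\<Sum>x\<le>n. \<Sum>y\<le>n. 1 + real m * (real (min x y) + real (min x (n - y)) - real x))"
  proof (intro sum.cong refl)
    fix x y assume "x \<in> {..n}" "y \<in> {..n}"
    then have xy: "x \<le> n" "y \<le> n" by auto
    have mx: "max 0 (int m * (int x + int y - int n)) = int m * (int x - int (min x (n - y)))"
    proof (cases "x \<le> n - y")
      case True
      then have "int x + int y - int n \<le> 0" using xy by linarith
      then have "int m * (int x + int y - int n) \<le> 0" by (rule mult_nonneg_nonpos[rotated]) simp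
      then show ?thesis using True by simp
    next
      case False
      then have "int x + int y - int n \<ge> 0" and ny: "int (n - y) = int n - int y" using xy by linarith+
      then have "max 0 (int m * (int x + int y - int n)) = int m * (int x + int y - int n)"
        by simp
      then show ?thesis using False ny by (simp add: algebra_simps)
    qed
    have "int x \<le> int (min x y) + int (min x (n - y))"
      using xy by linarith
    then have "0 \<le> int m * (int (min x y) + int (min x (n - y)) - int x)"
      by simp
    moreover have "F (x, y) = {int m * (int x - int (min x (n - y)))..int m * int (min x y)}"
      by (simp only: F_def mx prod.case)
    ultimately have "int (card (F (x, y))) = 1 + int m * (int (min x y) + int (min x (n - y)) - int x)"
      by (simp add: algebra_simps)
    then have "real_of_int (int (card (F (x, y)))) = real_of_int (1 + int m * (int (min x y) + int (min x (n - y)) - int x))"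
      by simp
    then show "real (card (F (x, y))) = 1 + real m * (real (min x y) + real (min x (n - y)) - real x)"
      by simp
  qed
  also have "\<dots> = (real n + 1)^2 + real m * (2 * (\<Sum>x\<le>n. \<Sum>y\<le>n. real (min x y)) - (\<Sum>x\<le>n. \<Sum>y\<le>n. real x))"
  proof -
    have reflect: "(\<Sum>y\<le>n. real (min x (n - y))) = (\<Sum>y\<le>n. real (min x y))" for x
      using sum.atLeastAtMost_rev[of "\<lambda>y. real (min x y)" 0 n] by (simp add: atMost_atLeast0)
    have "(\<Sum>x\<le>n. \<Sum>y\<le>n. 1 + real m * (real (min x y) + real (min x (n - y)) - real x))
      = (\<Sum>x\<le>n. \<Sum>y\<le>n. 1) + real m * ((\<Sum>x\<le>n. \<Sum>y\<le>n. real (min x y))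
          + (\<Sum>x\<le>n. \<Sum>y\<le>n. real (min x (n - y))) - (\<Sum>x\<le>n. \<Sum>y\<le>n. real x))"
      by (simp only: sum.distrib sum_subtractf sum_distrib_left[symmetric])
    also have "(\<Sum>x\<le>n. \<Sum>y\<le>n. 1 :: real) = (real n + 1)^2"
      by (simp add: power2_eq_square add.commute)
    finally show ?thesis
      by (simp only: reflect mult_2)
  qed
  also have "(\<Sum>x\<le>n. \<Sum>y\<le>n. real x) = (real n + 1) * (real n * (real n + 1) / 2)"
  proof -
    have "(\<Sum>x\<le>n. \<Sum>y\<le>n. real x) = (\<Sum>x\<le>n. (real n + 1) * real x)"
      by (simp add: add.commute)
    then show ?thesis by (simp only: sum_real_atMost flip: sum_distrib_left)
  qed
  also have "(real n + 1)^2 + real m * (2 * (\<Sum>x\<le>n. \<Sum>y\<le>n. real (min x y)) - (real n + 1) * (real n * (real n + 1) / 2))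
    = (real n + 1)^2 + real m * (real n ^ 3 - real n) / 6"
    unfolding sum_min_square by (simp add: field_simps power2_eq_square power3_eq_cube)
  finally show ?thesis by (simp add: ehrhart_count_def)
qed

section \<open>Negativity of the coefficients\<close>

text \<open>
  The Ehrhart polynomial of the Reeve tetrahedron of height \<open>6 M\<close>; the factor \<open>6\<close> clears the
  denominator of the volume.
\<close>
definition reeve_poly :: "nat \<Rightarrow> real poly" where
  "reeve_poly M = [:1, 2 - real M, 1, real M:]"

lemma ex_prism_over_reeve:
  assumes "M > 0" "l > 0"
  shows "\<exists>P. full_lattice_polytope (3 + k) P \<and>
    (\<forall>n\<ge>1. real (ehrhart_count (3 + k) P n) = poly (reeve_poly M * [:1, real l:] ^ k) (real n))"
proof (induction k)
  case 0
  have "(real n + 1)^2 + real (6 * M) * (real n ^ 3 - real n) / 6 = poly (reeve_poly M) (real n)" for n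
    by (simp add: reeve_poly_def field_simps power2_eq_square power3_eq_cube)
  then show ?case
    using full_lattice_polytope_reeve[of "6 * M"] ehrhart_count_reeve[of "6 * M"] \<open>M > 0\<close>
    by (intro exI[of _ "convex hull reeve_vertices (6 * M)"]) auto
next
  case (Suc k)
  then obtain P where P: "full_lattice_polytope (3 + k) P"
    "\<And>n. n \<ge> 1 \<Longrightarrow> real (ehrhart_count (3 + k) P n) = poly (reeve_poly M * [:1, real l:] ^ k) (real n)"
    by blast
  have "real (ehrhart_count (Suc (3 + k)) (prism (3 + k) l P) n)
      = poly (reeve_poly M * [:1, real l:] ^ Suc k) (real n)" if "n \<ge> 1" for n
    unfolding ehrhart_count_prism[OF full_lattice_polytope_subset[OF P(1)] that]
    using P(2)[OF that] by (simp add: algebra_simps)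
  then show ?case
    using full_lattice_polytope_prism[OF P(1) \<open>l > 0\<close>]
    by (intro exI[of _ "prism (3 + k) l P"]) simp
qed

text \<open>
  The ratio of the two terms is \<open>(k - i) (k + 1) / (i + 1)\<close>, where \<open>k - i \<ge> 1\<close> and \<open>k + 1 > i + 1\<close>.
\<close>
lemma binomial_terms_increase:
  assumes "i < k"
  shows "(k choose i) * Suc k ^ i < (k choose Suc i) * Suc k ^ Suc i"
proof -
  have ratio: "(k choose Suc i) * Suc i = (k choose i) * (k - i)"
    using binomial_absorb_comp[of k i] binomial_absorption[of i k] by (simp add: mult.commute)
  have "Suc i < (k - i) * Suc k"
  proof -
    have "Suc i < 1 * Suc k" using assms by simp
    also have "\<dots> \<le> (k - i) * Suc k" using assms by (intro mult_right_mono) auto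
    finally show ?thesis .
  qed
  then have "((k choose i) * Suc k ^ i) * Suc i < ((k choose i) * Suc k ^ i) * ((k - i) * Suc k)"
    using assms by (intro mult_strict_left_mono) auto
  also have "\<dots> = ((k choose i) * (k - i)) * Suc k ^ Suc i"
    by (simp only: power_Suc mult_ac)
  also have "\<dots> = ((k choose Suc i) * Suc k ^ Suc i) * Suc i"
    by (simp only: ratio[symmetric] mult_ac)
  finally show ?thesis
    by (rule mult_less_cancel2[THEN iffD1, THEN conjunct2])
qed

text \<open>
  For a general parameter \<open>M\<close> of the tetrahedron, the part of the coefficient that does not involve
  \<open>M\<close> is at most four times the largest coefficient \<open>(k + 1)\<^sup>k\<close> of \<open>(1 + (k + 1) n)\<^sup>k\<close>, and the part
  that involves it is at most \<open>-M\<close>; so \<open>M = 4 (k + 1)\<^sup>k + 1\<close> suffices.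
\<close>
lemma reeve_prism_coeff_negative:
  fixes k :: nat
  assumes "j \<in> {1..k + 1}"
  shows "coeff (reeve_poly (4 * (k + 1) ^ k + 1) * [:1, real (k + 1):] ^ k) j < 0"
proof -
  define b where "b i = (k choose i) * Suc k ^ i" for i
  define B where "B = Suc k ^ k"
  define q where "q = [:1, real (k + 1):] ^ k"
  have coeff_q: "coeff q i = real (b i)" for i
  proof (cases "i \<le> k")
    case True
    then show ?thesis
      by (simp add: q_def b_def coeff_linear_poly_power add.commute)
  next
    case False
    moreover have "degree q \<le> k"
      unfolding q_def by (rule order_trans[OF degree_power_le]) simp
    ultimately show ?thesis by (simp add: b_def coeff_eq_0)
  qed
  have step: "b i < b (Suc i)" if "i < k" for i
    using binomial_terms_increase[OF that] by (simp add: b_def)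
  have "b i \<le> b k" if "i \<le> k" for i
    using that by (induction rule: inc_induct) (auto dest: step)
  then have bound: "b i \<le> B" for i
    by (cases "i \<le> k") (force simp: b_def B_def binomial_eq_0)+
  obtain i where j: "j = Suc i" and i: "i \<le> k"
    using assms by (cases j) auto
  \<comment> \<open>the coefficients of index \<open>j - 3\<close> and \<open>j - 2\<close>, which vanish for a negative index\<close>
  define e where "e = (if i \<ge> 2 then b (i - 2) else 0)"
  define f where "f = (if i \<ge> 1 then b (i - 1) else 0)"
  have "e < b i"
  proof (cases "i \<ge> 2")
    case True
    then obtain i' where "i = Suc (Suc i')" by (metis add_2_eq_Suc le_Suc_ex)
    then show ?thesis using step[of i'] step[of "Suc i'"] i by (simp add: e_def)
  qed (use i in \<open>simp add: e_def b_def\<close>)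
  then have gap: "real e + 1 \<le> real (b i)" by linarith
  have "coeff (reeve_poly (4 * B + 1) * q) j
      = real (b (Suc i)) + 2 * real (b i) + real f - real (4 * B + 1) * (real (b i) - real e)"
    by (auto simp: reeve_poly_def j e_def f_def coeff_pCons coeff_q algebra_simps split: nat.split)
  also have "\<dots> \<le> real B + 2 * real B + real B - real (4 * B + 1) * 1"
    using bound gap by (intro diff_mono add_mono mult_left_mono) (auto simp: f_def)
  also have "\<dots> < 0" by simp
  finally show ?thesis by (simp add: q_def B_def)
qed

theorem theorem1:
  fixes d :: nat
  assumes "d \<ge> 4"
  shows "\<exists>N P. integral_polytope N P \<and> affine_dim P = d \<and>
           (\<forall>k\<in>{1..d - 2}. coeff (ehrhart_poly N P) k < 0)"
proof -
  define k where "k = d - 3"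
  have d: "3 + k = d" "k + 1 = d - 2" using assms by (auto simp: k_def)
  define M where "M = 4 * (k + 1) ^ k + 1"
  let ?p = "reeve_poly M * [:1, real (k + 1):] ^ k"
  obtain P where P: "full_lattice_polytope d P"
    "\<And>n. n \<ge> 1 \<Longrightarrow> real (ehrhart_count d P n) = poly ?p (real n)"
    using ex_prism_over_reeve[of M "k + 1" k] unfolding d(1) M_def by auto
  have "ehrhart_poly d P = ?p"
    by (rule ehrhart_poly_eqI) (rule P(2)[symmetric])
  moreover have "\<forall>j\<in>{1..d - 2}. coeff ?p j < 0"
    using reeve_prism_coeff_negative[of _ k] by (simp only: M_def flip: d(2)) blast
  ultimately have "\<forall>j\<in>{1..d - 2}. coeff (ehrhart_poly d P) j < 0"
    by simp
  then show ?thesis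
    using full_lattice_polytope_integral[OF P(1)] full_lattice_polytope_affine_dim[OF P(1)]
    by blast
qed

end
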